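(* Let $f:\mathbb N\to\mathbb N$ be a function with $f(n)\to\infty$ as $n\to\infty$. For every $n$ such that $f(n)\ge 3$ and $f(n)$ divides $n-2$, let $G_n$ be the generalized theta graph with $(n-2)/f(n)$ paths each having exactly $f(n)$ internal nodes. Then $G_n$ has $n$ vertices and $n(1+1/f(n))-2(1+1/f(n))$ edges (so edge density $1+1/f(n)-\frac{2}{n}(1+1/f(n))$), and Broadcast on $G_n$ requires exactly $(n-2)/f(n)$ ignorant agents, i.e. it is solvable with $k$ ignorant agents if and only if $k\ge (n-2)/f(n)$.
   Context: Generalized theta graph: two distinct fixed nodes (the poles) joined by internally vertex-disjoint paths, each path having a prescribed number of internal nodes. Edge density of a graph with $m$ edges and $n$ nodes is $m/n$. Broadcast model: a connected base graph $G=(V,E)$ with $n$ nodes. There is one source agent holding a message $\mathcal M$ and $k\ge1$ ignorant agents (agents not holding $\mathcal M$); initially all agents occupy pairwise distinct nodes, the initial placement being chosen by the adversary. Time proceeds in synchronous rounds; in each round: (1) the adversary removes a (possibly empty) set $E'\subseteq E$ of edges such that $(V,E\setminus E')$ is connected; (2) each agent (agents have unique IDs, local memory, and see the entire current graph, the positions of all agents and which agents hold $\mathcal M$) chooses either to stay or to traverse an edge of $E\setminus E'$ incident to its current node; (3) agents move. Whenever an ignorant agent is at the same node as an agent holding $\mathcal M$, it receives $\mathcal M$ and becomes a source agent. The adversary is adaptive and knows the agents' strategy. Broadcast is solvable on $G$ with $k$ ignorant agents if the agents have a strategy such that, for every initial placement and every adversary behaviour, after finitely many rounds all agents hold $\mathcal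 M$; otherwise the adversary is said to have a winning strategy. *)

theory Defs
  imports Complex_Main
begin

section \<open>Graphs\<close>

text \<open>An undirected simple graph is given by a vertex set V and a set E of
  2-element edges (each edge is the set of its two endpoints).\<close>

definition adj :: "'v set set \<Rightarrow> ('v \<times> 'v) set" where
  "adj E = {(x, y). {x, y} \<in> E}"

definition connected_graph :: "'v set \<Rightarrow> 'v set set \<Rightarrow> bool" where
  "connected_graph V E \<longleftrightarrow> (\<forall>u\<in>V. \<forall>w\<in>V. (u, w) \<in> (adj E)\<^sup>*)"

section \<open>Generalized theta graphs\<close>

datatype tvert = Pole bool | Inner nat nat

text \<open>Generalized theta graph with poles Pole False and Pole True, and one path
  per entry of ls; path i has internal nodes Inner i 1, ..., Inner i (ls!i).\<close>

definition theta_V :: "nat list \<Rightarrow> tvert set" where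
  "theta_V ls = {Pole False, Pole True} \<union>
     {Inner i j | i j. i < length ls \<and> 1 \<le> j \<and> j \<le> ls ! i}"

definition theta_E :: "nat list \<Rightarrow> tvert set set" where
  "theta_E ls =
     {{Inner i j, Inner i (Suc j)} | i j. i < length ls \<and> 1 \<le> j \<and> j < ls ! i}
   \<union> {{Pole False, Inner i 1} | i. i < length ls \<and> 1 \<le> ls ! i}
   \<union> {{Inner i (ls ! i), Pole True} | i. i < length ls \<and> 1 \<le> ls ! i}
   \<union> {{Pole False, Pole True} | i. i < length ls \<and> ls ! i = 0}"

section \<open>The Broadcast game\<close>

text \<open>Agents are 0..k; agent 0 is the initial source, agents 1..k are ignorant.
  A configuration consists of the positions of the agents and the set of agents
  holding the message.\<close>

type_synonym 'v cfg = "(nat \<Rightarrow> 'v) \<times> nat set"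

text \<open>A history is the list of observations made so far: for each round, the
  set of edges removed by the adversary in that round together with the
  configuration at the start of that round.\<close>

type_synonym 'v hist = "('v set set \<times> 'v cfg) list"

text \<open>Joint (deterministic, full-information, full-memory) agent strategy:
  maps the history (whose last entry contains the current removed edges and the
  current configuration) to the target node of every agent.\<close>
type_synonym 'v strategy = "'v hist \<Rightarrow> nat \<Rightarrow> 'v"

text \<open>Adaptive adversary: given the previous history and the current
  configuration, chooses the set of edges removed in the current round.\<close>
type_synonym 'v adversary = "'v hist \<Rightarrow> 'v cfg \<Rightarrow> 'v set set"

definition step :: "nat \<Rightarrow> 'v cfg \<Rightarrow> (nat \<Rightarrow> 'v) \<Rightarrow> 'v cfg" where
  "step k c mv = (mv, snd c \<union> {a. a \<le> k \<and> (\<exists>b\<in>snd c. mv b = mv a)})"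

fun run :: "nat \<Rightarrow> 'v strategy \<Rightarrow> 'v adversary \<Rightarrow> (nat \<Rightarrow> 'v) \<Rightarrow> nat \<Rightarrow> 'v hist" where
  "run k \<sigma> adv p0 0 = [(adv [] (p0, {0}), (p0, {0}))]"
| "run k \<sigma> adv p0 (Suc t) =
     (let H = run k \<sigma> adv p0 t;
          c' = step k (snd (last H)) (\<sigma> H)
      in H @ [(adv H c', c')])"

text \<open>Removed edges / configuration in round t.\<close>
definition removed_at :: "nat \<Rightarrow> 'v strategy \<Rightarrow> 'v adversary \<Rightarrow> (nat \<Rightarrow> 'v) \<Rightarrow> nat \<Rightarrow> 'v set set" where
  "removed_at k \<sigma> adv p0 t = fst (run k \<sigma> adv p0 t ! t)"

definition cfg_at :: "nat \<Rightarrow> 'v strategy \<Rightarrow> 'v adversary \<Rightarrow> (nat \<Rightarrow> 'v) \<Rightarrow> nat \<Rightarrow> 'v cfg" where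
  "cfg_at k \<sigma> adv p0 t = snd (run k \<sigma> adv p0 t ! t)"

text \<open>The adversary's choice is admissible: a subset of E whose removal keeps
  the graph connected.\<close>
definition adm_removal :: "'v set \<Rightarrow> 'v set set \<Rightarrow> 'v set set \<Rightarrow> bool" where
  "adm_removal V E R \<longleftrightarrow> R \<subseteq> E \<and> connected_graph V (E - R)"

text \<open>Each agent stays or traverses a present edge incident to its node.\<close>
definition legal_moves :: "'v set set \<Rightarrow> nat \<Rightarrow> 'v set set \<Rightarrow> 'v cfg \<Rightarrow> 'v cfg \<Rightarrow> bool" where
  "legal_moves E k R c c' \<longleftrightarrow>
     (\<forall>a\<le>k. fst c' a = fst c a \<or> {fst c a, fst c' a} \<in> E - R)"

definition broadcast_solvable :: "'v set \<Rightarrow> 'v set set \<Rightarrow> nat \<Rightarrow> bool" where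
  "broadcast_solvable V E k \<longleftrightarrow>
    (\<exists>\<sigma> :: 'v strategy.
      \<forall>p0. inj_on p0 {..k} \<and> p0 ` {..k} \<subseteq> V \<longrightarrow>
      (\<forall>adv :: 'v adversary.
         (\<forall>t. adm_removal V E (removed_at k \<sigma> adv p0 t)) \<longrightarrow>
         (\<forall>t. legal_moves E k (removed_at k \<sigma> adv p0 t)
                (cfg_at k \<sigma> adv p0 t) (cfg_at k \<sigma> adv p0 (Suc t)))
         \<and> (\<exists>t. {..k} \<subseteq> snd (cfg_at k \<sigma> adv p0 t))))"

end

theory Submission
  imports Defs "HOL-Library.Disjoint_Sets"
begin

text \<open>
  An admissible removal cuts each path at most once and leaves some path intact.

  With at most \<open>p\<close> agents in total, the adversary keeps one pole, together with the stretch of the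
  source's path between that pole and the source, free of ignorant agents, by cutting all paths
  except one. A source standing on the pole is only left a path without ignorant agents inside. If
  the source is inside a path, it is cut off from the rest of that path, provided that some other
  path may stay intact because no ignorant agent stands next to the pole on it. Otherwise the
  ignorant agents stand next to the pole on all other paths, one on each, so that cutting these
  paths locks them in for the next round, as each path has at least two internal nodes.

  With \<open>p + 1\<close> agents, informed and ignorant ones can be forced to meet. Two agents inside one
  path move apart until one of them reaches a pole, as a single cut cannot stop both; so
  eventually every path has at most one agent inside and some agent \<open>e\<close> is on a pole. Assign the
  other \<open>p\<close> agents to the \<open>p\<close> paths. Those of the kind opposite to \<open>e\<close> head for its pole, the
  others for the opposite pole; the intact path gives progress in every round. Either \<open>e\<close> is met,
  or agents of its kind hold both poles and squeeze an opposite agent between them.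
\<close>

section \<open>Injections and bijections\<close>

lemma ex_inj_on_representatives:
  assumes "disjoint_family_on M I" and "\<And>i. i \<in> I \<Longrightarrow> \<exists>a\<in>A. f a \<in> M i"
  obtains g where "inj_on g I" "g ` I \<subseteq> A" "\<And>i. i \<in> I \<Longrightarrow> f (g i) \<in> M i"
proof -
  obtain g where g_rep: "\<And>i. i \<in> I \<Longrightarrow> g i \<in> A \<and> f (g i) \<in> M i"
    using assms(2) by metis
  moreover have "inj_on g I"
  proof (rule inj_onI, rule ccontr)
    fix i j assume "i \<in> I" "j \<in> I" "g i = g j" "i \<noteq> j"
    then show False
      using g_rep[of i] g_rep[of j] disjoint_family_onD[OF assms(1)] by fastforce
  qed
  ultimately show ?thesis
    using that by blast
qed

lemma bij_betw_extension:
  assumes "finite A" "finite B" "card A = card B"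
    and "U \<subseteq> A" "inj_on g U" "g ` U \<subseteq> B"
  obtains h where "bij_betw h A B" "\<And>a. a \<in> U \<Longrightarrow> h a = g a"
proof -
  have "finite U"
    using assms(1,4) by (rule finite_subset[rotated])
  then have "card (A - U) = card (B - g ` U)"
    using assms by (simp add: card_Diff_subset card_image)
  then obtain f where "bij_betw f (A - U) (B - g ` U)"
    using assms(1,2) finite_same_card_bij by blast
  then have "bij_betw (\<lambda>a. if a \<in> U then g a else f a) (U \<union> (A - U)) (g ` U \<union> (B - g ` U))"
    using assms(5) by (intro bij_betw_disjoint_Un) (auto simp: bij_betw_def)
  then show ?thesis
    using that assms(4,6) by (simp add: Un_absorb1)
qed

section \<open>Connected graphs\<close>

lemma connected_graph_closed_set:
  assumes "connected_graph V G" "x \<in> V" "y \<in> V" "x \<in> S"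
    and "\<And>u v. u \<in> S \<Longrightarrow> {u, v} \<in> G \<Longrightarrow> v \<in> S"
  shows "y \<in> S"
proof -
  have "(x, y) \<in> (adj G)\<^sup>*"
    using assms unfolding connected_graph_def by blast
  then show ?thesis
    by (induction rule: rtrancl_induct) (use assms in \<open>auto simp: adj_def\<close>)
qed

lemma sym_adj: "sym (adj G)"
  by (auto simp: sym_def adj_def insert_commute)

lemma connected_graph_if_all_reachable:
  assumes "\<And>v. v \<in> V \<Longrightarrow> (r, v) \<in> (adj G)\<^sup>*"
  shows "connected_graph V G"
  unfolding connected_graph_def
  using assms sym_rtrancl[OF sym_adj] by (meson rtrancl_trans symD)

lemma reachable_edge_iff:
  assumes "{x, y} \<in> G"
  shows "(r, x) \<in> (adj G)\<^sup>* \<longleftrightarrow> (r, y) \<in> (adj G)\<^sup>*"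
proof -
  have "(x, y) \<in> adj G" "(y, x) \<in> adj G"
    using assms by (auto simp: adj_def insert_commute)
  then show ?thesis
    by (meson rtrancl.rtrancl_into_rtrancl)
qed

section \<open>Runs of the Broadcast game\<close>

lemma length_run [simp]: "length (run k \<sigma> adv p0 t) = Suc t"
  by (induction t) (auto simp: Let_def)

lemma last_run: "last (run k \<sigma> adv p0 t) = (removed_at k \<sigma> adv p0 t, cfg_at k \<sigma> adv p0 t)"
proof -
  have "run k \<sigma> adv p0 t \<noteq> []"
    by (metis length_run list.size(3) nat.distinct(1))
  then show ?thesis
    by (simp add: last_conv_nth removed_at_def cfg_at_def)
qed

lemma cfg_at_0 [simp]: "cfg_at k \<sigma> adv p0 0 = (p0, {0})"
  by (simp add: cfg_at_def)

lemma cfg_at_Suc: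
  "cfg_at k \<sigma> adv p0 (Suc t) = step k (cfg_at k \<sigma> adv p0 t) (\<sigma> (run k \<sigma> adv p0 t))"
  using last_run[of k \<sigma> adv p0 t] by (simp add: cfg_at_def Let_def nth_append)

lemma removed_at_adversary: "\<exists>H. removed_at k \<sigma> adv p0 t = adv H (cfg_at k \<sigma> adv p0 t)"
  by (cases t) (auto simp: removed_at_def cfg_at_def Let_def nth_append)

lemma fst_step [simp]: "fst (step k c mv) = mv"
  by (simp add: step_def)

definition hop :: "'v set set \<Rightarrow> 'v \<Rightarrow> 'v \<Rightarrow> bool" where
  "hop G x y \<longleftrightarrow> y = x \<or> {x, y} \<in> G"

lemma hop_commute: "hop G x y \<longleftrightarrow> hop G y x"
  by (auto simp: hop_def insert_commute)

lemma legal_moves_iff_hop: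
  "legal_moves E k R c c' \<longleftrightarrow> (\<forall>a\<le>k. hop (E - R) (fst c a) (fst c' a))"
  by (simp add: legal_moves_def hop_def)

section \<open>Winning the game as the adversary\<close>

definition confines ::
    "'v set \<Rightarrow> 'v set set \<Rightarrow> nat \<Rightarrow> ((nat \<Rightarrow> 'v) \<Rightarrow> bool) \<Rightarrow> (nat \<Rightarrow> 'v) \<Rightarrow> 'v set set \<Rightarrow> bool" where
  "confines V E k P pos R \<longleftrightarrow> adm_removal V E R \<and>
     (\<forall>mv. (\<forall>a\<le>k. hop (E - R) (pos a) (mv a)) \<longrightarrow> P mv)"

lemma ex_confining_adversary:
  fixes p0 :: "nat \<Rightarrow> 'v"
  assumes "P p0" and "\<And>pos. P pos \<Longrightarrow> \<exists>R. confines V E k P pos R"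
  obtains adv :: "'v adversary" where "\<And>H c. adm_removal V E (adv H c)"
    and "\<And>H c. P (fst c) \<Longrightarrow> confines V E k P (fst c) (adv H c)"
proof -
  obtain R where R_confines: "\<And>pos. P pos \<Longrightarrow> confines V E k P pos (R pos)"
    using assms(2) by metis
  show ?thesis
  proof (rule that)
    fix c :: "'v cfg"
    show "adm_removal V E (R (if P (fst c) then fst c else p0))"
      using R_confines assms(1) by (simp add: confines_def)
    show "P (fst c) \<Longrightarrow> confines V E k P (fst c) (R (if P (fst c) then fst c else p0))"
      using R_confines by simp
  qed
qed

lemma step_source_alone:
  assumes "snd c = {0}" and "\<And>a. a \<in> {1..k} \<Longrightarrow> mv a \<noteq> mv 0"
  shows "snd (step k c mv) = {0}"
proof -
  have "a = 0" if "a \<le> k" "mv a = mv 0" for a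
    using assms(2)[of a] that by (cases a) auto
  then show ?thesis
    using assms(1) by (auto simp: step_def)
qed

lemma not_broadcast_solvableI:
  fixes V :: "'v set" and P :: "(nat \<Rightarrow> 'v) \<Rightarrow> bool"
  assumes "1 \<le> k" and start: "inj_on p0 {..k}" "p0 ` {..k} \<subseteq> V" "P p0"
    and alone: "\<And>pos a. P pos \<Longrightarrow> a \<in> {1..k} \<Longrightarrow> pos a \<noteq> pos 0"
    and confining: "\<And>pos. P pos \<Longrightarrow> \<exists>R. confines V E k P pos R"
  shows "\<not> broadcast_solvable V E k"
proof
  assume "broadcast_solvable V E k"
  then obtain \<sigma> :: "'v strategy" where
    legal_if_adm: "\<And>adv t. (\<And>t. adm_removal V E (removed_at k \<sigma> adv p0 t)) \<Longrightarrow>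
      legal_moves E k (removed_at k \<sigma> adv p0 t) (cfg_at k \<sigma> adv p0 t) (cfg_at k \<sigma> adv p0 (Suc t))"
    and informed_if_adm: "\<And>adv. (\<And>t. adm_removal V E (removed_at k \<sigma> adv p0 t)) \<Longrightarrow>
      \<exists>t. {..k} \<subseteq> snd (cfg_at k \<sigma> adv p0 t)"
    using start(1,2) unfolding broadcast_solvable_def by metis
  obtain adv :: "'v adversary" where adm: "\<And>H c. adm_removal V E (adv H c)"
    and confines: "\<And>H c. P (fst c) \<Longrightarrow> confines V E k P (fst c) (adv H c)"
    using ex_confining_adversary[OF start(3) confining] by blast
  let ?R = "removed_at k \<sigma> adv p0" and ?c = "cfg_at k \<sigma> adv p0"
  have adm_play: "adm_removal V E (?R t)" for t
    using adm removed_at_adversary by metis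
  have "P (fst (?c t)) \<and> snd (?c t) = {0}" for t
  proof (induction t)
    case 0
    then show ?case using start(3) by simp
  next
    case (Suc t)
    then have "confines V E k P (fst (?c t)) (?R t)"
      using removed_at_adversary[of k \<sigma> adv p0 t] confines by metis
    then have "P (fst (?c (Suc t)))"
      using legal_if_adm[OF adm_play] unfolding confines_def legal_moves_iff_hop by blast
    moreover from this have "snd (?c (Suc t)) = {0}"
      using Suc alone unfolding cfg_at_Suc by (intro step_source_alone) auto
    ultimately show ?case ..
  qed
  then have "{..k} \<subseteq> {0}"
    using informed_if_adm[OF adm_play] by metis
  then show False
    using assms(1) by auto
qed

section \<open>Winning the game as the agents\<close>

primrec wins_within :: "'v set \<Rightarrow> 'v set set \<Rightarrow> nat \<Rightarrow> nat \<Rightarrow> 'v cfg \<Rightarrow> bool" where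
  "wins_within V E k 0 c \<longleftrightarrow> {..k} \<subseteq> snd c"
| "wins_within V E k (Suc m) c \<longleftrightarrow> wins_within V E k m c \<or>
     (\<forall>R. adm_removal V E R \<longrightarrow>
       (\<exists>mv. legal_moves E k R c (step k c mv) \<and> wins_within V E k m (step k c mv)))"

definition wins :: "'v set \<Rightarrow> 'v set set \<Rightarrow> nat \<Rightarrow> 'v cfg \<Rightarrow> bool" where
  "wins V E k c \<longleftrightarrow> (\<exists>m. wins_within V E k m c)"

lemma wins_within_mono: "wins_within V E k m c \<Longrightarrow> m \<le> m' \<Longrightarrow> wins_within V E k m' c"
  by (induction m' rule: nat_induct) (auto simp: le_Suc_eq)

lemma wins_if_all_informed: "{..k} \<subseteq> snd c \<Longrightarrow> wins V E k c"
  unfolding wins_def by (metis wins_within.simps(1))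

lemma winsI:
  assumes "finite E"
    and "\<And>R. adm_removal V E R \<Longrightarrow>
           \<exists>mv. legal_moves E k R c (step k c mv) \<and> wins V E k (step k c mv)"
  shows "wins V E k c"
proof -
  let ?A = "{R. adm_removal V E R}"
  have "?A \<subseteq> Pow E"
    by (auto simp: adm_removal_def)
  then have finite_A: "finite ?A"
    using assms(1) finite_subset by blast
  obtain m where m_wins: "\<And>R. adm_removal V E R \<Longrightarrow>
      \<exists>mv. legal_moves E k R c (step k c mv) \<and> wins_within V E k (m R) (step k c mv)"
    using assms(2) unfolding wins_def by metis
  have "m R \<le> Max (m ` ?A)" if "adm_removal V E R" for R
    using finite_A that by simp
  with m_wins have "wins_within V E k (Suc (Max (m ` ?A))) c"
    by (simp, meson wins_within_mono)
  then show ?thesis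
    unfolding wins_def by blast
qed

definition optimal_move :: "'v set \<Rightarrow> 'v set set \<Rightarrow> nat \<Rightarrow> 'v set set \<Rightarrow> 'v cfg \<Rightarrow> (nat \<Rightarrow> 'v) \<Rightarrow> bool"
  where "optimal_move V E k R c mv \<longleftrightarrow> legal_moves E k R c (step k c mv) \<and>
     (\<forall>m. wins_within V E k m c \<longrightarrow> wins_within V E k (m - 1) (step k c mv))"

lemma ex_optimal_move:
  assumes "adm_removal V E R"
  shows "\<exists>mv. optimal_move V E k R c mv"
proof (cases "wins V E k c")
  case False
  then show ?thesis
    by (intro exI[of _ "fst c"]) (auto simp: optimal_move_def wins_def legal_moves_def)
next
  case True
  define r where "r = (LEAST m. wins_within V E k m c)"
  have r_wins: "wins_within V E k r c"
    using True unfolding r_def wins_def by (metis LeastI_ex)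
  have r_le: "r \<le> m" if "wins_within V E k m c" for m
    using that unfolding r_def by (rule Least_le)
  have "\<exists>mv. legal_moves E k R c (step k c mv) \<and> wins_within V E k (r - 1) (step k c mv)"
  proof (cases r)
    case 0
    with r_wins show ?thesis
      by (intro exI[of _ "fst c"]) (auto simp: legal_moves_def step_def)
  next
    case (Suc m)
    then have "\<not> wins_within V E k m c"
      using r_le by fastforce
    with r_wins Suc assms show ?thesis
      by auto
  qed
  then show ?thesis
    unfolding optimal_move_def using r_le by (meson diff_le_mono wins_within_mono)
qed

lemma broadcast_solvableI:
  fixes V :: "'v set"
  assumes "\<And>p0. inj_on p0 {..k} \<Longrightarrow> p0 ` {..k} \<subseteq> V \<Longrightarrow> wins V E k (p0, {0})"
  shows "broadcast_solvable V E k"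
proof -
  have "\<forall>R c. \<exists>mv. adm_removal V E R \<longrightarrow> optimal_move V E k R c mv"
    using ex_optimal_move by blast
  then obtain mv where mv_optimal: "\<And>R c. adm_removal V E R \<Longrightarrow> optimal_move V E k R c (mv R c)"
    by metis
  define \<sigma> :: "'v strategy" where "\<sigma> H = mv (fst (last H)) (snd (last H))" for H
  show ?thesis
    unfolding broadcast_solvable_def
  proof (intro exI[of _ \<sigma>] allI impI conjI)
    fix p0 :: "nat \<Rightarrow> 'v" and adv :: "'v adversary"
    assume adm: "\<forall>t. adm_removal V E (removed_at k \<sigma> adv p0 t)"
    have optimal: "optimal_move V E k (removed_at k \<sigma> adv p0 t) (cfg_at k \<sigma> adv p0 t)
        (\<sigma> (run k \<sigma> adv p0 t))" for t
      using mv_optimal adm by (simp add: \<sigma>_def last_run)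
    then show "legal_moves E k (removed_at k \<sigma> adv p0 t)
        (cfg_at k \<sigma> adv p0 t) (cfg_at k \<sigma> adv p0 (Suc t))" for t
      by (simp add: optimal_move_def cfg_at_Suc)
    assume "inj_on p0 {..k} \<and> p0 ` {..k} \<subseteq> V"
    then obtain N where start_wins: "wins_within V E k N (p0, {0})"
      using assms unfolding wins_def by blast
    have "wins_within V E k (N - t) (cfg_at k \<sigma> adv p0 t)" for t
    proof (induction t)
      case 0
      then show ?case using start_wins by simp
    next
      case (Suc t)
      then show ?case
        using optimal[of t] by (auto simp: optimal_move_def cfg_at_Suc)
    qed
    from this[of N] show "\<exists>t. {..k} \<subseteq> snd (cfg_at k \<sigma> adv p0 t)"
      by auto
  qed
qed

section \<open>Forcing a meeting\<close>

text \<open>Moving one agent per round suffices. The set \<open>S\<close> of informed agents does not change before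
  the meeting, so that informed and ignorant agents play symmetric roles.\<close>

inductive forces_meeting :: "'v set \<Rightarrow> 'v set set \<Rightarrow> nat \<Rightarrow> nat set \<Rightarrow> (nat \<Rightarrow> 'v) \<Rightarrow> bool"
  for V E k S where
  meet: "a \<le> k \<Longrightarrow> b \<le> k \<Longrightarrow> a \<in> S \<Longrightarrow> b \<notin> S \<Longrightarrow> pos a = pos b \<Longrightarrow> forces_meeting V E k S pos"
| move: "(\<And>R. adm_removal V E R \<Longrightarrow>
      \<exists>a v. a \<le> k \<and> {pos a, v} \<in> E - R \<and> forces_meeting V E k S (pos(a := v))) \<Longrightarrow>
    forces_meeting V E k S pos"

definition opposed :: "nat set \<Rightarrow> nat \<Rightarrow> nat \<Rightarrow> bool" where
  "opposed S a b \<longleftrightarrow> (a \<in> S) \<noteq> (b \<in> S)"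

lemma forces_meeting_opposed:
  assumes "a \<le> k" "b \<le> k" "opposed S a b" "pos a = pos b"
  shows "forces_meeting V E k S pos"
  using assms meet[of a k b S pos] meet[of b k a S pos] by (auto simp: opposed_def)

lemma wins_step_if_wins_more_informed:
  assumes "mv ` {..k} \<subseteq> V" and "snd (step k (pos, S) mv) = S \<Longrightarrow> wins V E k (mv, S)"
    and "\<And>mv S'. mv ` {..k} \<subseteq> V \<Longrightarrow> S \<subset> S' \<Longrightarrow> S' - S \<subseteq> {..k} \<Longrightarrow> wins V E k (mv, S')"
  shows "wins V E k (step k (pos, S) mv)"
proof -
  have "S \<subseteq> snd (step k (pos, S) mv)" "snd (step k (pos, S) mv) - S \<subseteq> {..k}"
    by (auto simp: step_def)
  then have "wins V E k (mv, snd (step k (pos, S) mv))"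
    using assms by (metis psubsetI)
  then show ?thesis
    by (metis fst_step prod.collapse)
qed

lemma wins_if_forces_meeting:
  assumes "forces_meeting V E k S pos" "pos ` {..k} \<subseteq> V" "finite E" "\<Union>E \<subseteq> V"
    and more_informed: "\<And>mv S'. mv ` {..k} \<subseteq> V \<Longrightarrow> S \<subset> S' \<Longrightarrow> S' - S \<subseteq> {..k} \<Longrightarrow>
      wins V E k (mv, S')"
  shows "wins V E k (pos, S)"
  using assms(1,2)
proof (induction pos rule: forces_meeting.induct)
  case (meet a b pos)
  then have "snd (step k (pos, S) pos) \<noteq> S"
    by (auto simp: step_def)
  then have "wins V E k (step k (pos, S) pos)"
    using meet.prems more_informed by (intro wins_step_if_wins_more_informed) auto
  then show ?case
    by (intro winsI[OF assms(3)] exI[of _ pos]) (auto simp: legal_moves_def)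
next
  case (move pos)
  show ?case
  proof (rule winsI[OF assms(3)])
    fix R assume "adm_removal V E R"
    then obtain a v where edge: "{pos a, v} \<in> E - R"
      and wins: "(pos(a := v)) ` {..k} \<subseteq> V \<Longrightarrow> wins V E k (pos(a := v), S)"
      using move.IH by blast
    have "(pos(a := v)) ` {..k} \<subseteq> V"
      using edge assms(4) move.prems by auto
    then have "wins V E k (step k (pos, S) (pos(a := v)))"
      using wins more_informed by (intro wins_step_if_wins_more_informed) auto
    moreover have "legal_moves E k R (pos, S) (step k (pos, S) (pos(a := v)))"
      using edge by (auto simp: legal_moves_def)
    ultimately show "\<exists>mv. legal_moves E k R (pos, S) (step k (pos, S) mv) \<and>
        wins V E k (step k (pos, S) mv)"
      by blast
  qed
qed

lemma wins_if_meetings_forced: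
  assumes "finite E" "\<Union>E \<subseteq> V"
    and forced: "\<And>pos S. pos ` {..k} \<subseteq> V \<Longrightarrow> S \<inter> {..k} \<noteq> {} \<Longrightarrow> \<not> {..k} \<subseteq> S \<Longrightarrow>
      forces_meeting V E k S pos"
    and "pos ` {..k} \<subseteq> V" "S \<inter> {..k} \<noteq> {}"
  shows "wins V E k (pos, S)"
  using assms(4,5)
proof (induction "card ({..k} - S)" arbitrary: pos S rule: less_induct)
  case less
  show ?case
  proof (cases "{..k} \<subseteq> S")
    case True
    then show ?thesis
      by (simp add: wins_if_all_informed)
  next
    case False
    show ?thesis
    proof (rule wins_if_forces_meeting[OF forced[OF less.prems False] less.prems(1) assms(1,2)])
      fix mv S' assume valid: "mv ` {..k} \<subseteq> V" and more: "S \<subset> S'" "S' - S \<subseteq> {..k}"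
      from more have "{..k} - S' \<subset> {..k} - S"
        by blast
      then show "wins V E k (mv, S')"
        using valid more(1) less.prems(2) by (intro less.hyps psubset_card_mono) auto
    qed
  qed
qed

section \<open>Theta graphs in path coordinates\<close>

definition link :: "(nat \<Rightarrow> nat \<Rightarrow> 'v) \<Rightarrow> nat \<Rightarrow> nat \<Rightarrow> 'v set" where
  "link node i j = {node i j, node i (Suc j)}"

definition mirrored :: "(nat \<Rightarrow> nat) \<Rightarrow> (nat \<Rightarrow> nat \<Rightarrow> 'v) \<Rightarrow> nat \<Rightarrow> nat \<Rightarrow> 'v" where
  "mirrored len node i j = node i (Suc (len i) - j)"

lemma mirrored_mirrored: "j \<le> Suc (len i) \<Longrightarrow> mirrored len (mirrored len node) i j = node i j"
  by (simp add: mirrored_def)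

lemma link_mirrored: "j \<le> len i \<Longrightarrow> link (mirrored len node) i j = link node i (len i - j)"
  by (auto simp: link_def mirrored_def Suc_diff_le)

lemma image_diff_atLeastAtMost_nat:
  fixes a b n :: nat
  assumes "a \<le> n" "b \<le> n"
  shows "(\<lambda>j. n - j) ` {a..b} = {n - b..n - a}"
proof (intro equalityI subsetI)
  fix j assume "j \<in> {n - b..n - a}"
  then show "j \<in> (\<lambda>j. n - j) ` {a..b}"
    using assms by (intro image_eqI[of _ _ "n - j"]) auto
qed auto

lemma image_mirrored: "mirrored len node i ` {..Suc (len i)} = node i ` {..Suc (len i)}"
proof -
  have "mirrored len node i ` {..Suc (len i)} = node i ` (\<lambda>j. Suc (len i) - j) ` {..Suc (len i)}"
    unfolding image_image by (intro image_cong) (simp_all add: mirrored_def)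
  then show ?thesis
    by (simp add: atMost_atLeast0 image_diff_atLeastAtMost_nat)
qed

lemma image_link_mirrored: "link (mirrored len node) i ` {..len i} = link node i ` {..len i}"
proof -
  have "link (mirrored len node) i ` {..len i} = link node i ` (\<lambda>j. len i - j) ` {..len i}"
    unfolding image_image by (intro image_cong) (simp_all add: link_mirrored)
  then show ?thesis
    by (simp add: atMost_atLeast0 image_diff_atLeastAtMost_nat)
qed

text \<open>\<open>node i j\<close> is the \<open>j\<close>-th node of path \<open>i\<close>, where positions \<open>0\<close> and \<open>Suc (len i)\<close> are the two
  poles for every \<open>i\<close>. The axioms are invariant under exchanging the poles, which halves all case
  distinctions.\<close>

locale theta_paths =
  fixes V :: "'v set" and E :: "'v set set" and p :: nat and len :: "nat \<Rightarrow> nat"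
    and node :: "nat \<Rightarrow> nat \<Rightarrow> 'v"
  assumes p_pos: "0 < p"
    and len_pos: "i < p \<Longrightarrow> 1 \<le> len i"
    and V_eq: "V = (\<Union>i<p. node i ` {..Suc (len i)})"
    and E_eq: "E = (\<Union>i<p. link node i ` {..len i})"
    and node_eq_iff: "i < p \<Longrightarrow> i' < p \<Longrightarrow> j \<le> Suc (len i) \<Longrightarrow> j' \<le> Suc (len i') \<Longrightarrow>
      node i j = node i' j' \<longleftrightarrow>
        i = i' \<and> j = j' \<or> j = 0 \<and> j' = 0 \<or> j = Suc (len i) \<and> j' = Suc (len i')"
begin

lemma theta_paths_mirrored: "theta_paths V E p len (mirrored len node)"
proof
  show "V = (\<Union>i<p. mirrored len node i ` {..Suc (len i)})"
    by (simp only: V_eq image_mirrored)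
  show "E = (\<Union>i<p. link (mirrored len node) i ` {..len i})"
    by (simp only: E_eq image_link_mirrored)
next
  fix i i' j j'
  assume "i < p" "i' < p" "j \<le> Suc (len i)" "j' \<le> Suc (len i')"
  then show "mirrored len node i j = mirrored len node i' j' \<longleftrightarrow>
      i = i' \<and> j = j' \<or> j = 0 \<and> j' = 0 \<or> j = Suc (len i) \<and> j' = Suc (len i')"
    using node_eq_iff[of i i' "Suc (len i) - j" "Suc (len i') - j'"] by (auto simp: mirrored_def)
qed (use p_pos len_pos in auto)

lemma left_pole_eq: "i < p \<Longrightarrow> i' < p \<Longrightarrow> node i 0 = node i' 0"
  by (simp add: node_eq_iff)

lemma right_pole_eq: "i < p \<Longrightarrow> i' < p \<Longrightarrow> node i (Suc (len i)) = node i' (Suc (len i'))"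
  by (simp add: node_eq_iff)

lemma node_in_V: "i < p \<Longrightarrow> j \<le> Suc (len i) \<Longrightarrow> node i j \<in> V"
  by (auto simp: V_eq)

lemma link_in_E: "i < p \<Longrightarrow> j \<le> len i \<Longrightarrow> link node i j \<in> E"
  by (auto simp: E_eq)

lemma finite_E: "finite E"
  by (simp add: E_eq)

lemma Union_E_subset: "\<Union>E \<subseteq> V"
  by (auto simp: E_eq link_def intro!: node_in_V)

lemma edge_cases:
  assumes "{x, y} \<in> E"
  obtains i j where "i < p" "j \<le> len i" "x = node i j" "y = node i (Suc j)"
  | i j where "i < p" "j \<le> len i" "x = node i (Suc j)" "y = node i j"
  using assms unfolding E_eq link_def by (auto simp: doubleton_eq_iff)

lemma link_eq_iff:
  assumes "i < p" "i' < p" "j \<le> len i" "j' \<le> len i'"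
  shows "link node i j = link node i' j' \<longleftrightarrow> i = i' \<and> j = j'"
proof
  assume "link node i j = link node i' j'"
  then have "j = j' \<and> node i j = node i' j' \<and> node i (Suc j) = node i' (Suc j')"
    using assms by (auto simp: link_def doubleton_eq_iff node_eq_iff)
  then show "i = i' \<and> j = j'"
    using assms len_pos[OF assms(1)] by (auto simp: node_eq_iff)
qed simp

lemma card_E: "card E = (\<Sum>i<p. Suc (len i))"
proof -
  have "inj_on (\<lambda>(i, j). link node i j) (SIGMA i:{..<p}. {..len i})"
    by (auto simp: inj_on_def link_eq_iff)
  moreover have "E = (\<lambda>(i, j). link node i j) ` (SIGMA i:{..<p}. {..len i})"
    by (auto simp: E_eq)
  ultimately show ?thesis
    by (simp add: card_image)
qed

lemma hop_inner_cases:
  assumes "hop (E - R) (node i j) v" "i < p" "1 \<le> j" "j \<le> len i"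
  obtains (stay) "v = node i j"
  | (down) "v = node i (j - 1)" "link node i (j - 1) \<notin> R"
  | (up) "v = node i (Suc j)" "link node i j \<notin> R"
proof (cases "v = node i j")
  case False
  then have edge: "{node i j, v} \<in> E" "{node i j, v} \<notin> R"
    using assms(1) by (auto simp: hop_def)
  from edge(1) show ?thesis
  proof (cases rule: edge_cases)
    case (1 i' j')
    then have "i' = i" "j' = j"
      using assms(2-) by (auto simp: node_eq_iff)
    then show ?thesis
      using 1 edge(2) by (intro up) (auto simp: link_def)
  next
    case (2 i' j')
    then have "i' = i" "j = Suc j'"
      using assms(2-) by (auto simp: node_eq_iff)
    then show ?thesis
      using 2 edge(2) by (intro down) (auto simp: link_def insert_commute)
  qed
qed (use stay in simp)

lemma hop_pole_cases:
  assumes "hop (E - R) (node i 0) v" "i < p"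
  obtains (stay) "v = node i 0"
  | (enter) i' where "i' < p" "v = node i' 1" "link node i' 0 \<notin> R"
proof (cases "v = node i 0")
  case False
  then have edge: "{node i 0, v} \<in> E" "{node i 0, v} \<notin> R"
    using assms(1) by (auto simp: hop_def)
  from edge(1) show ?thesis
  proof (cases rule: edge_cases)
    case (1 i' j')
    then have "j' = 0"
      using assms(2) by (auto simp: node_eq_iff)
    then show ?thesis
      using 1 edge(2) by (intro enter[of i']) (auto simp: link_def)
  next
    case (2 i' j')
    then show ?thesis
      using assms(2) by (simp add: node_eq_iff)
  qed
qed (use stay in simp)

section \<open>Admissible removals in theta graphs\<close>

lemma mem_iff_if_closed_under_links:
  assumes "adm_removal V E R" "x \<in> V" "y \<in> V"
    and "\<And>i j. i < p \<Longrightarrow> j \<le> len i \<Longrightarrow> link node i j \<notin> R \<Longrightarrow> node i j \<in> S \<longleftrightarrow> node i (Suc j) \<in> S"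
  shows "x \<in> S \<longleftrightarrow> y \<in> S"
proof -
  have closed: "v \<in> S" if "u \<in> S" "{u, v} \<in> E - R" for u v
  proof -
    have "{u, v} \<in> E" "{u, v} \<notin> R"
      using that(2) by auto
    then show ?thesis
      using that(1) assms(4) by (cases rule: edge_cases) (metis insert_commute link_def)+
  qed
  have "connected_graph V (E - R)"
    using assms(1) by (simp add: adm_removal_def)
  then have "v \<in> S" if "u \<in> V" "v \<in> V" "u \<in> S" for u v
    using that closed by (rule connected_graph_closed_set)
  then show ?thesis
    using assms(2,3) by blast
qed

lemma removed_link_unique:
  assumes "adm_removal V E R" "i < p" "j1 \<le> len i" "j2 \<le> len i"
    and "link node i j1 \<in> R" "link node i j2 \<in> R"
  shows "j1 = j2"
  using assms(3-)
proof (induction j1 j2 rule: linorder_wlog)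
  case (le j1 j2)
  show ?case
  proof (rule ccontr)
    assume "j1 \<noteq> j2"
    define S where "S = node i ` {j1<..j2}"
    have mem_S: "node i' j' \<in> S \<longleftrightarrow> i' = i \<and> j1 < j' \<and> j' \<le> j2"
      if "i' < p" "j' \<le> Suc (len i')" for i' j'
      using that assms(2) le.prems by (auto simp: S_def node_eq_iff)
    have "node i 0 \<in> S \<longleftrightarrow> node i j2 \<in> S"
    proof (rule mem_iff_if_closed_under_links[OF assms(1)])
      fix i' j assume "i' < p" "j \<le> len i'" "link node i' j \<notin> R"
      moreover from this have "\<not> (i' = i \<and> (j = j1 \<or> j = j2))"
        using le.prems by auto
      ultimately show "node i' j \<in> S \<longleftrightarrow> node i' (Suc j) \<in> S"
        by (auto simp: mem_S)
    qed (use assms(2) le.prems in \<open>auto intro: node_in_V\<close>)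
    then show False
      using mem_S[of i 0] mem_S[of i j2] assms(2) le \<open>j1 \<noteq> j2\<close> by simp
  qed
qed simp

lemma ex_intact_path:
  assumes "adm_removal V E R"
  obtains i where "i < p" "\<And>j. j \<le> len i \<Longrightarrow> link node i j \<notin> R"
proof (rule ccontr)
  assume "\<not> thesis"
  with that have "\<forall>i. i < p \<longrightarrow> (\<exists>j\<le>len i. link node i j \<in> R)"
    by blast
  then obtain c where cut: "\<And>i. i < p \<Longrightarrow> c i \<le> len i \<and> link node i (c i) \<in> R"
    by metis
  define S where "S = (\<Union>i<p. node i ` {..c i})"
  have mem_S: "node i j \<in> S \<longleftrightarrow> j \<le> c i" if "i < p" "j \<le> Suc (len i)" for i j
    using that cut unfolding S_def by (fastforce simp: node_eq_iff)
  have "node 0 0 \<in> S \<longleftrightarrow> node 0 (Suc (len 0)) \<in> S"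
  proof (rule mem_iff_if_closed_under_links[OF assms])
    fix i j assume "i < p" "j \<le> len i" "link node i j \<notin> R"
    moreover from this have "j \<noteq> c i"
      using cut by auto
    ultimately show "node i j \<in> S \<longleftrightarrow> node i (Suc j) \<in> S"
      by (auto simp: mem_S)
  qed (use p_pos node_in_V in auto)
  then show False
    using mem_S[of 0] cut[of 0] p_pos by auto
qed

definition cut_all_but :: "nat \<Rightarrow> (nat \<Rightarrow> nat) \<Rightarrow> 'v set set" where
  "cut_all_but q c = (\<lambda>i. link node i (c i)) ` ({..<p} - {q})"

lemma link_in_cut_all_but_iff:
  assumes "\<And>i. i < p \<Longrightarrow> c i \<le> len i" "i < p" "j \<le> len i"
  shows "link node i j \<in> cut_all_but q c \<longleftrightarrow> i \<noteq> q \<and> j = c i"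
proof -
  have "link node i j = link node i' (c i') \<longleftrightarrow> i = i' \<and> j = c i'" if "i' < p" for i'
    using assms that by (intro link_eq_iff) auto
  then show ?thesis
    using assms(2) by (auto simp: cut_all_but_def)
qed

lemma V_subset_if_closed_under_uncut_links:
  assumes "q < p" "node q 0 \<in> S"
    and closed: "\<And>i j. i < p \<Longrightarrow> j \<le> len i \<Longrightarrow> (i \<noteq> q \<Longrightarrow> j \<noteq> c i) \<Longrightarrow>
      node i j \<in> S \<longleftrightarrow> node i (Suc j) \<in> S"
  shows "V \<subseteq> S"
proof -
  have before_cut: "node i j \<in> S" if "i < p" "j \<le> Suc (len i)" "i \<noteq> q \<Longrightarrow> j \<le> c i" for i j
    using that(2-)
  proof (induction j)
    case 0
    then show ?case
      using left_pole_eq[OF that(1) assms(1)] assms(2) by simp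
  next
    case (Suc j)
    then show ?case
      using closed[OF that(1), of j] by (cases "i = q") auto
  qed
  have after_cut: "node i j \<in> S" if "i < p" "c i < j" "j \<le> Suc (len i)" for i j
    using that(3,2)
  proof (induction j rule: inc_induct)
    case base
    then show ?case
      using before_cut[OF assms(1), of "Suc (len q)"] right_pole_eq[OF that(1) assms(1)] by simp
  next
    case (step j)
    then show ?case
      using closed[OF that(1), of j] by auto
  qed
  have "node i j \<in> S" if "i < p" "j \<le> Suc (len i)" for i j
    using before_cut[OF that] after_cut[OF that(1) _ that(2)] by (cases "j \<le> c i") auto
  then show ?thesis
    by (auto simp: V_eq)
qed

lemma adm_removal_cut_all_but:
  assumes "q < p" and cut_le: "\<And>i. i < p \<Longrightarrow> c i \<le> len i"
  shows "adm_removal V E (cut_all_but q c)"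
proof -
  define G where "G = E - cut_all_but q c"
  have "V \<subseteq> {v. (node q 0, v) \<in> (adj G)\<^sup>*}"
  proof (rule V_subset_if_closed_under_uncut_links[OF assms(1)])
    fix i j assume "i < p" "j \<le> len i" "i \<noteq> q \<Longrightarrow> j \<noteq> c i"
    then have "link node i j \<in> G"
      using link_in_E link_in_cut_all_but_iff[OF cut_le] by (auto simp: G_def)
    then show "node i j \<in> {v. (node q 0, v) \<in> (adj G)\<^sup>*} \<longleftrightarrow>
        node i (Suc j) \<in> {v. (node q 0, v) \<in> (adj G)\<^sup>*}"
      unfolding link_def mem_Collect_eq by (rule reachable_edge_iff)
  qed simp
  then have "connected_graph V G"
    by (intro connected_graph_if_all_reachable) auto
  then show ?thesis
    using cut_le link_in_E by (auto simp: adm_removal_def G_def cut_all_but_def)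
qed

lemma confines_cut_all_but:
  assumes "q < p" "\<And>i. i < p \<Longrightarrow> c i \<le> len i"
    and "\<And>mv. (\<And>a. a \<le> k \<Longrightarrow> hop (E - cut_all_but q c) (pos a) (mv a)) \<Longrightarrow> P mv"
  shows "\<exists>R. confines V E k P pos R"
  using assms adm_removal_cut_all_but
  by (intro exI[of _ "cut_all_but q c"]) (simp add: confines_def)

definition interior :: "nat \<Rightarrow> 'v set" where
  "interior i = node i ` {1..len i}"

lemma node_in_interior_iff:
  "i < p \<Longrightarrow> i' < p \<Longrightarrow> j \<le> Suc (len i) \<Longrightarrow> node i j \<in> interior i' \<longleftrightarrow> i = i' \<and> 1 \<le> j \<and> j \<le> len i"
  by (auto simp: interior_def node_eq_iff)

lemma disjoint_interiors: "disjoint_family_on interior {..<p}"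
  unfolding disjoint_family_on_def interior_def by (auto simp: node_eq_iff)

end

section \<open>Too few agents: shielding the source\<close>

locale long_theta_paths = theta_paths V E p len node
  for V :: "'v set" and E p len node +
  assumes len_ge_2: "i < p \<Longrightarrow> 2 \<le> len i"
begin

lemma long_theta_paths_mirrored: "long_theta_paths V E p len (mirrored len node)"
  by (intro long_theta_paths.intro theta_paths_mirrored) (unfold_locales, rule len_ge_2)

definition shielded :: "nat \<Rightarrow> (nat \<Rightarrow> 'v) \<Rightarrow> bool" where
  "shielded k pos \<longleftrightarrow> (\<exists>q<p. \<exists>j\<le>len q. pos 0 = node q j \<and>
     (\<forall>a\<in>{1..k}. pos a \<notin> node q ` {..j}))"

lemma shieldedI:
  "q < p \<Longrightarrow> j \<le> len q \<Longrightarrow> pos 0 = node q j \<Longrightarrow>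
    (\<And>a. a \<in> {1..k} \<Longrightarrow> pos a \<notin> node q ` {..j}) \<Longrightarrow> shielded k pos"
  unfolding shielded_def by blast

lemma ex_vacant_path:
  assumes "k < p"
  obtains i where "i < p" "\<And>a. a \<in> {1..k} \<Longrightarrow> pos a \<notin> interior i"
proof (rule ccontr)
  assume "\<not> thesis"
  with that have "\<exists>a\<in>{1..k}. pos a \<in> interior i" if "i \<in> {..<p}" for i
    using that by blast
  then obtain g where "inj_on g {..<p}" "g ` {..<p} \<subseteq> {1..k}"
    by (rule ex_inj_on_representatives[OF disjoint_interiors])
  then have "card {..<p} \<le> card {1..k}"
    by (intro card_inj_on_le) auto
  then show False
    using assms by simp
qed

lemma not_hop_to_vacant_path:
  assumes "q < p" "v \<notin> interior q" "v \<noteq> node q 0" "j \<le> 1"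
    and intact: "\<And>i. i < p \<Longrightarrow> link node i 0 \<notin> R \<Longrightarrow> i = q"
  shows "\<not> hop (E - R) v (node q j)"
proof
  assume "hop (E - R) v (node q j)"
  then have hop: "hop (E - R) (node q j) v"
    by (simp add: hop_commute)
  have inner: "node q 1 \<in> interior q" "node q 2 \<in> interior q"
    using len_ge_2[OF assms(1)] by (auto simp: interior_def)
  show False
  proof (cases "j = 0")
    case True
    with hop have "hop (E - R) (node q 0) v"
      by simp
    then show False
      using assms(1) by (cases rule: hop_pole_cases) (use assms(2,3) inner intact in auto)
  next
    case False
    with hop assms(4) have "hop (E - R) (node q 1) v"
      by (simp add: le_Suc_eq)
    then show False
      using assms(1-3) inner len_pos[OF assms(1)]
      by (elim hop_inner_cases) (auto simp: numeral_2_eq_2)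
  qed
qed

lemma confines_shielded_at_pole:
  assumes "k < p" "q < p" "pos 0 = node q 0" "\<And>a. a \<in> {1..k} \<Longrightarrow> pos a \<noteq> node q 0"
  shows "\<exists>R. confines V E k (shielded k) pos R"
proof -
  obtain r where "r < p" and vacant: "\<And>a. a \<in> {1..k} \<Longrightarrow> pos a \<notin> interior r"
    using ex_vacant_path[OF assms(1)] by metis
  note pole_eq = left_pole_eq[OF assms(2) \<open>r < p\<close>]
  have intact: "i = r" if "i < p" "link node i 0 \<notin> cut_all_but r (\<lambda>_. 0)" for i
    using that link_in_cut_all_but_iff[of "\<lambda>_. 0" i 0 r] by auto
  show ?thesis
  proof (rule confines_cut_all_but[OF \<open>r < p\<close>])
    fix mv assume mv: "\<And>a. a \<le> k \<Longrightarrow> hop (E - cut_all_but r (\<lambda>_. 0)) (pos a) (mv a)"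
    have away: "mv a \<noteq> node r j" if "a \<in> {1..k}" "j \<le> 1" for a j
      using not_hop_to_vacant_path[OF \<open>r < p\<close> vacant[OF that(1)] _ that(2) intact]
        mv[of a] assms(4)[OF that(1)] that(1) pole_eq by auto
    have "hop (E - cut_all_but r (\<lambda>_. 0)) (node r 0) (mv 0)"
      using mv[of 0] assms(3) pole_eq by simp
    then have "mv 0 \<in> node r ` {..1}"
      using \<open>r < p\<close> by (cases rule: hop_pole_cases) (auto dest: intact)
    then obtain j where "j \<le> 1" "mv 0 = node r j"
      by auto
    then show "shielded k mv"
      using \<open>r < p\<close> len_pos[OF \<open>r < p\<close>] away by (intro shieldedI[of r j]) auto
  qed simp
qed

lemma hop_into_stretch:
  assumes "hop (E - R) v (node q i)" "q < p" "i \<le> j" "j \<le> len q" "link node q j \<in> R"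
    and outside: "v \<notin> node q ` {..j}"
  obtains r where "r < p" "r \<noteq> q" "v = node r 1" "link node r 0 \<notin> R"
proof (cases "i = 0")
  case True
  then have "hop (E - R) (node q 0) v"
    using assms(1) by (simp add: hop_commute)
  then show ?thesis
    using assms(2)
  proof (cases rule: hop_pole_cases)
    case (enter r)
    moreover have "r \<noteq> q"
      using enter assms(5) outside by (cases "j = 0") auto
    ultimately show ?thesis
      using that by blast
  qed (use outside in auto)
next
  case False
  with assms(3,4) have "1 \<le> i" "i \<le> len q"
    by auto
  moreover have "hop (E - R) (node q i) v"
    using assms(1) by (simp add: hop_commute)
  ultimately show ?thesis
    using assms(2)
  proof (elim hop_inner_cases)
    assume "v = node q (Suc i)" "link node q i \<notin> R"
    then show ?thesis
      using assms(3,5) outside by (cases "i = j") auto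
  qed (use assms(3) outside in auto)
qed

lemma confines_shielded_inside:
  assumes "q < p" "1 \<le> j" "j \<le> len q" "pos 0 = node q j"
    and outside: "\<And>a. a \<in> {1..k} \<Longrightarrow> pos a \<notin> node q ` {..j}"
    and "r < p" "r \<noteq> q" and gate_free: "\<And>a. a \<in> {1..k} \<Longrightarrow> pos a \<noteq> node r 1"
  shows "\<exists>R. confines V E k (shielded k) pos R"
proof -
  define c where "c = (\<lambda>_. 0 :: nat)(q := j)"
  define R where "R = cut_all_but r c"
  have cut_le: "c i \<le> len i" for i
    using assms(3) by (simp add: c_def)
  have removed: "link node q j \<in> R"
    and intact: "\<And>i. i < p \<Longrightarrow> link node i 0 \<notin> R \<Longrightarrow> i = r \<or> i = q"
    using link_in_cut_all_but_iff[of c] cut_le assms(1-3,7)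
    by (auto simp: R_def c_def split: if_splits)
  show ?thesis
  proof (rule confines_cut_all_but[OF \<open>r < p\<close> cut_le, folded R_def])
    fix mv assume mv: "\<And>a. a \<le> k \<Longrightarrow> hop (E - R) (pos a) (mv a)"
    have "mv a \<noteq> node q i" if "a \<in> {1..k}" "i \<le> j" for a i
    proof
      assume "mv a = node q i"
      then have "hop (E - R) (pos a) (node q i)"
        using mv[of a] that(1) by simp
      then show False
        using hop_into_stretch[OF _ assms(1) that(2) assms(3) removed outside[OF that(1)]]
          intact gate_free[OF that(1)] by metis
    qed
    moreover have "hop (E - R) (node q j) (mv 0)"
      using mv[of 0] assms(4) by simp
    then have "mv 0 \<in> node q ` {..j}"
      using assms(1-3) removed by (elim hop_inner_cases) auto
    then obtain i where "i \<le> j" "mv 0 = node q i"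
      by auto
    ultimately show "shielded k mv"
      using assms(1,3) by (intro shieldedI[of q i]) auto
  qed
qed

lemma agents_at_gates:
  assumes "k < p" "q < p" and gates: "\<And>i. i < p \<Longrightarrow> i \<noteq> q \<Longrightarrow> \<exists>a\<in>{1..k}. pos a = node i 1"
    and "a \<in> {1..k}"
  obtains i where "i < p" "i \<noteq> q" "pos a = node i 1"
proof -
  have "disjoint_family_on (\<lambda>i. {node i 1}) ({..<p} - {q})"
    using len_pos by (fastforce simp: disjoint_family_on_def node_eq_iff)
  then obtain g where g: "inj_on g ({..<p} - {q})" "g ` ({..<p} - {q}) \<subseteq> {1..k}"
    "\<And>i. i \<in> {..<p} - {q} \<Longrightarrow> pos (g i) \<in> {node i 1}"
    using gates by (elim ex_inj_on_representatives[of _ _ "{1..k}" pos]) auto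
  have "g ` ({..<p} - {q}) = {1..k}"
    using g(1,2) assms(1,2) by (intro card_seteq) (auto simp: card_image)
  then obtain i where "i \<in> {..<p} - {q}" "a = g i"
    using assms(4) by blast
  then show ?thesis
    using that g(3) by auto
qed

lemma hop_from_gate:
  assumes "hop (E - R) (node i 1) v" "i < p" "link node i 0 \<in> R"
  shows "v \<in> interior i"
proof -
  have "v = node i 1 \<or> v = node i 2"
    using assms len_pos[OF assms(2)] by (elim hop_inner_cases) (auto simp: numeral_2_eq_2)
  then show ?thesis
    using len_ge_2[OF assms(2)] by (auto simp: interior_def)
qed

end

context long_theta_paths
begin

interpretation mirror: long_theta_paths V E p len "mirrored len node"
  by (rule long_theta_paths_mirrored)

lemma confines_shielded_blockade:
  assumes "q < p" "1 \<le> j" "j \<le> len q" "pos 0 = node q j"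
    and at_gates: "\<And>a. a \<in> {1..k} \<Longrightarrow> \<exists>i<p. i \<noteq> q \<and> pos a = node i 1"
  shows "\<exists>R. confines V E k (\<lambda>pos. shielded k pos \<or> mirror.shielded k pos) pos R"
proof (rule confines_cut_all_but[OF assms(1)])
  let ?R = "cut_all_but q (\<lambda>_. 0)"
  fix mv assume mv: "\<And>a. a \<le> k \<Longrightarrow> hop (E - ?R) (pos a) (mv a)"
  have away: "mv a \<noteq> node q m" if agent: "a \<in> {1..k}" and m_le: "m \<le> Suc (len q)" for a m
  proof -
    obtain i where "i < p" "i \<noteq> q" "pos a = node i 1"
      using at_gates[OF agent] by blast
    moreover from this have "link node i 0 \<in> ?R"
      using link_in_cut_all_but_iff[of "\<lambda>_. 0" i 0 q] by simp
    ultimately have "mv a \<in> interior i"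
      using mv[of a] agent hop_from_gate[of ?R i "mv a"] by simp
    then show ?thesis
      using node_in_interior_iff[OF assms(1) \<open>i < p\<close> m_le] \<open>i \<noteq> q\<close> by auto
  qed
  have "hop (E - ?R) (node q j) (mv 0)"
    using mv[of 0] assms(4) by simp
  then have "mv 0 \<in> node q ` {..Suc (len q)}"
    using assms(1-3) by (elim hop_inner_cases) auto
  then consider i where "i \<le> len q" "mv 0 = node q i" | "mv 0 = mirrored len node q 0"
    by (auto simp: le_Suc_eq mirrored_def)
  then show "shielded k mv \<or> mirror.shielded k mv"
  proof cases
    case 1
    then have "shielded k mv"
      using assms(1) away by (intro shieldedI[of q i]) auto
    then show ?thesis ..
  next
    case 2
    then have "mirror.shielded k mv"
      using assms(1) away by (intro mirror.shieldedI[of q 0]) (auto simp: mirrored_def)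
    then show ?thesis ..
  qed
qed simp

lemma confines_shielded:
  assumes "k < p" "shielded k pos"
  shows "\<exists>R. confines V E k (\<lambda>pos. shielded k pos \<or> mirror.shielded k pos) pos R"
proof -
  have weaken: "\<exists>R. confines V E k (\<lambda>pos. shielded k pos \<or> mirror.shielded k pos) pos R"
    if "\<exists>R. confines V E k (shielded k) pos R"
    using that by (auto simp: confines_def)
  obtain q j where shield: "q < p" "j \<le> len q" "pos 0 = node q j"
    "\<And>a. a \<in> {1..k} \<Longrightarrow> pos a \<notin> node q ` {..j}"
    using assms(2) unfolding shielded_def by blast
  consider (pole) "j = 0"
    | (gap) r where "1 \<le> j" "r < p" "r \<noteq> q" "\<And>a. a \<in> {1..k} \<Longrightarrow> pos a \<noteq> node r 1"
    | (blockade) "1 \<le> j" "\<And>i. i < p \<Longrightarrow> i \<noteq> q \<Longrightarrow> \<exists>a\<in>{1..k}. pos a = node i 1"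
    by (metis One_nat_def Suc_leI neq0_conv)
  then show ?thesis
  proof cases
    case pole
    then show ?thesis
      using shield by (intro weaken confines_shielded_at_pole[OF assms(1)]) auto
  next
    case gap
    then show ?thesis
      using shield by (intro weaken confines_shielded_inside[of q j _ _ r]) auto
  next
    case blockade
    then show ?thesis
      using shield agents_at_gates[OF assms(1) shield(1) blockade(2)]
      by (intro confines_shielded_blockade[of q j]) (metis+)
  qed
qed

end

context long_theta_paths
begin

interpretation mirror: long_theta_paths V E p len "mirrored len node"
  by (rule long_theta_paths_mirrored)

lemma shielded_mirrored_mirrored:
  "long_theta_paths.shielded p len (mirrored len (mirrored len node)) k pos \<longleftrightarrow> shielded k pos"
proof -
  interpret mirror2: long_theta_paths V E p len "mirrored len (mirrored len node)"
    by (rule mirror.long_theta_paths_mirrored)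
  have "mirrored len (mirrored len node) q ` {..j} = node q ` {..j}" if "j \<le> len q" for q j
    using that by (intro image_cong) (auto simp: mirrored_mirrored)
  then show ?thesis
    unfolding mirror2.shielded_def shielded_def
    by (simp add: mirrored_mirrored cong: conj_cong)
qed

lemma not_broadcast_solvable_if_too_few_agents:
  assumes "1 \<le> k" "k < p"
  shows "\<not> broadcast_solvable V E k"
proof -
  define p0 where "p0 = case_nat (node 0 0) (\<lambda>i. node i 1)"
  show ?thesis
  proof (rule not_broadcast_solvableI[where P = "\<lambda>pos. shielded k pos \<or> mirror.shielded k pos"
        and ?p0.0 = p0])
    have "node i 1 \<noteq> node 0 0" "node i 1 = node i' 1 \<longleftrightarrow> i = i'" if "i < p" "i' < p" for i i'
      using that len_pos[OF that(1)] p_pos by (auto simp: node_eq_iff)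
    then show "inj_on p0 {..k}"
      using assms by (auto simp: inj_on_def p0_def eq_commute[of "node 0 0"] split: nat.splits)
    show "p0 ` {..k} \<subseteq> V"
      using assms by (auto simp: p0_def intro!: node_in_V split: nat.splits)
    have "shielded k p0"
      using assms by (intro shieldedI[of 0 0]) (auto simp: p0_def node_eq_iff split: nat.splits)
    then show "shielded k p0 \<or> mirror.shielded k p0" ..
  next
    fix pos assume inv: "shielded k pos \<or> mirror.shielded k pos"
    show "pos a \<noteq> pos 0" if "a \<in> {1..k}" for a
      using inv that unfolding shielded_def mirror.shielded_def by fastforce
    show "\<exists>R. confines V E k (\<lambda>pos. shielded k pos \<or> mirror.shielded k pos) pos R"
      using inv
    proof
      assume "mirror.shielded k pos"
      from mirror.confines_shielded[OF assms(2) this] show ?thesis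
        by (simp only: shielded_mirrored_mirrored disj_commute)
    qed (rule confines_shielded[OF assms(2)])
  qed (rule assms)
qed

end

section \<open>Enough agents: forcing a meeting\<close>

context theta_paths
begin

text \<open>No removal stops both agents, as it cuts the path at most once.\<close>

lemma forces_meeting_race:
  assumes "q < p" "a \<le> k" "b \<le> k" "a \<noteq> b"
    and walk_a: "\<And>s. s < m \<Longrightarrow> \<alpha> s \<le> len q \<and> {x s, x (Suc s)} = link node q (\<alpha> s)"
    and walk_b: "\<And>t. t < n \<Longrightarrow> \<beta> t \<le> len q \<and> {y t, y (Suc t)} = link node q (\<beta> t)"
    and disjoint: "\<And>s t. s < m \<Longrightarrow> t < n \<Longrightarrow> \<alpha> s \<noteq> \<beta> t"
    and finish: "\<And>s t. s \<le> m \<Longrightarrow> t \<le> n \<Longrightarrow> s = m \<or> t = n \<Longrightarrow>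
      forces_meeting V E k S (pos(a := x s, b := y t))"
  shows "forces_meeting V E k S (pos(a := x 0, b := y 0))"
proof -
  have "forces_meeting V E k S (pos(a := x s, b := y t))" if "s \<le> m" "t \<le> n" for s t
    using that
  proof (induction "(m - s) + (n - t)" arbitrary: s t rule: less_induct)
    case less
    show ?case
    proof (cases "s = m \<or> t = n")
      case False
      let ?pos = "pos(a := x s, b := y t)"
      have unfinished: "s < m" "t < n"
        using False less.prems by auto
      have "forces_meeting V E k S (?pos(a := x (Suc s)))"
        "forces_meeting V E k S (?pos(b := y (Suc t)))"
        using less.hyps[of "Suc s" t] less.hyps[of s "Suc t"] unfinished assms(4)
        by (simp_all add: fun_upd_twist)
      moreover have "{?pos a, x (Suc s)} \<in> E - R \<or> {?pos b, y (Suc t)} \<in> E - R"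
        if "adm_removal V E R" for R
        using removed_link_unique[OF that assms(1), of "\<alpha> s" "\<beta> t"]
          link_in_E[OF assms(1)] walk_a[OF unfinished(1)] walk_b[OF unfinished(2)]
          disjoint[OF unfinished] assms(4) by auto
      ultimately show ?thesis
        using assms(2,3) by (intro forces_meeting.move) blast
    qed (use less.prems finish in blast)
  qed
  from this[of 0 0] show ?thesis
    by simp
qed

lemma forces_meeting_squeeze:
  assumes "x1 \<le> k" "x2 \<le> k" "y \<le> k" and opposed: "opposed S x1 y" "opposed S x2 y"
    and "q < p" and pos: "pos x1 = node q j1" "pos y = node q j" "pos x2 = node q j2"
    and between: "j1 \<le> j" "j \<le> j2" "j2 \<le> Suc (len q)"
  shows "forces_meeting V E k S pos"
proof (cases "x1 = x2")
  case True
  then have "j1 = j2"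
    using pos(1,3) between \<open>q < p\<close> by (auto simp: node_eq_iff)
  then show ?thesis
    using assms by (intro forces_meeting_opposed[of x1 k y]) auto
next
  case False
  have distinct: "x1 \<noteq> y" "x2 \<noteq> y"
    using opposed by (auto simp: opposed_def)
  have "forces_meeting V E k S (pos(x1 := node q (j1 + 0), x2 := node q (j2 - 0)))"
  proof (rule forces_meeting_race[OF \<open>q < p\<close> assms(1,2) False,
        where m = "j - j1" and n = "j2 - j" and \<alpha> = "\<lambda>s. j1 + s" and \<beta> = "\<lambda>t. j2 - Suc t"])
    show "j1 + s \<le> len q \<and> {node q (j1 + s), node q (j1 + Suc s)} = link node q (j1 + s)"
      if "s < j - j1" for s
      using that between by (simp add: link_def)
    show "j2 - Suc t \<le> len q \<and> {node q (j2 - t), node q (j2 - Suc t)} = link node q (j2 - Suc t)"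
      if "t < j2 - j" for t
      using that between by (auto simp: link_def Suc_diff_Suc)
    show "forces_meeting V E k S (pos(x1 := node q (j1 + s), x2 := node q (j2 - t)))"
      if "s = j - j1 \<or> t = j2 - j" for s t
      using that
    proof
      assume "s = j - j1"
      then show ?thesis
        using assms distinct False by (intro forces_meeting_opposed[of x1 k y]) auto
    next
      assume "t = j2 - j"
      then show ?thesis
        using assms distinct by (intro forces_meeting_opposed[of x2 k y]) auto
    qed
  qed (use between in auto)
  moreover have "pos(x1 := node q (j1 + 0), x2 := node q (j2 - 0)) = pos"
    using pos by auto
  ultimately show ?thesis
    by simp
qed

definition poles :: "'v set" where
  "poles = {node 0 0, node 0 (Suc (len 0))}"

lemma node_in_poles_iff:
  "i < p \<Longrightarrow> j \<le> Suc (len i) \<Longrightarrow> node i j \<in> poles \<longleftrightarrow> j = 0 \<or> j = Suc (len i)"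
  using p_pos by (auto simp: poles_def node_eq_iff)

lemma forces_meeting_drive_out:
  assumes "q < p" and "a \<le> k" "b \<le> k" "a \<noteq> b"
    and pos: "pos a = node q i" "pos b = node q j" and ordered: "i \<le> j" "j \<le> Suc (len q)"
    and finish: "\<And>x y. x \<in> V \<Longrightarrow> y \<in> V \<Longrightarrow> x \<in> poles \<or> y \<in> poles \<Longrightarrow>
      forces_meeting V E k S (pos(a := x, b := y))"
  shows "forces_meeting V E k S pos"
proof -
  have "forces_meeting V E k S (pos(a := node q (i - 0), b := node q (j + 0)))"
  proof (rule forces_meeting_race[OF \<open>q < p\<close> assms(2-4),
        where m = i and n = "Suc (len q) - j" and \<alpha> = "\<lambda>s. i - Suc s" and \<beta> = "\<lambda>t. j + t"])
    show "i - Suc s \<le> len q \<and> {node q (i - s), node q (i - Suc s)} = link node q (i - Suc s)"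
      if "s < i" for s
      using that ordered by (auto simp: link_def Suc_diff_Suc)
    show "j + t \<le> len q \<and> {node q (j + t), node q (j + Suc t)} = link node q (j + t)"
      if "t < Suc (len q) - j" for t
      using that ordered by (auto simp: link_def)
    show "forces_meeting V E k S (pos(a := node q (i - s), b := node q (j + t)))"
      if "s \<le> i" "t \<le> Suc (len q) - j" "s = i \<or> t = Suc (len q) - j" for s t
      using that ordered \<open>q < p\<close> by (intro finish node_in_V) (auto simp: node_in_poles_iff)
  qed (use ordered in auto)
  moreover have "pos(a := node q (i - 0), b := node q (j + 0)) = pos"
    using pos by auto
  ultimately show ?thesis
    by simp
qed

text \<open>Coordinates counted from the pole agent \<open>a\<close> heads for when agent \<open>e\<close> is on the left one.\<close>

definition target_coords :: "nat set \<Rightarrow> nat \<Rightarrow> nat \<Rightarrow> nat \<Rightarrow> nat \<Rightarrow> 'v" where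
  "target_coords S e a = (if opposed S a e then node else mirrored len node)"

lemma image_target_coords:
  "target_coords S e a i ` {..Suc (len i)} = node i ` {..Suc (len i)}"
  by (simp add: target_coords_def image_mirrored)

lemma target_coords_edge:
  assumes "i < p" "d \<le> len i" "\<And>j. j \<le> len i \<Longrightarrow> link node i j \<notin> R"
  shows "{target_coords S e a i (Suc d), target_coords S e a i d} \<in> E - R"
proof -
  have "link (target_coords S e a) i d = link node i (if opposed S a e then d else len i - d)"
    using assms(2) by (simp add: target_coords_def link_mirrored)
  also have "\<dots> \<in> E - R"
    using assms link_in_E[OF assms(1)] by simp
  finally show ?thesis
    by (simp add: link_def insert_commute)
qed

lemma forces_meeting_target_reached:
  assumes "e \<le> k" "pos e = node 0 0" "a \<le> k" "i < p" "pos a = target_coords S e a i 0"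
    and "y \<le> k" "opposed S y e" "q < p" "pos y \<in> node q ` {..Suc (len q)}"
  shows "forces_meeting V E k S pos"
proof (cases "opposed S a e")
  case True
  then have "pos a = pos e"
    using assms left_pole_eq[OF assms(4) p_pos] by (simp add: target_coords_def)
  then show ?thesis
    using assms True by (intro forces_meeting_opposed[of a k e])
next
  case False
  then have "opposed S e y" "opposed S a y"
    using assms(7) by (auto simp: opposed_def)
  moreover have "pos e = node q 0" "pos a = node q (Suc (len q))"
    using assms False left_pole_eq[OF p_pos assms(8)] right_pole_eq[OF assms(4,8)]
    by (auto simp: target_coords_def mirrored_def)
  ultimately show ?thesis
    using assms by (auto intro: forces_meeting_squeeze[of e k a y S q pos 0 _ "Suc (len q)"])
qed

lemma ex_step_towards_target:
  assumes "adm_removal V E R" and \<pi>: "bij_betw \<pi> A {..<p}"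
    and coords: "\<And>a. a \<in> A \<Longrightarrow> d a \<le> Suc (len (\<pi> a)) \<and> pos a = target_coords S e a (\<pi> a) (d a)"
    and "\<And>a. a \<in> A \<Longrightarrow> d a \<noteq> 0"
  obtains a d' where "a \<in> A" "d a = Suc d'" "{pos a, target_coords S e a (\<pi> a) d'} \<in> E - R"
proof -
  obtain i where "i < p" and intact: "\<And>j. j \<le> len i \<Longrightarrow> link node i j \<notin> R"
    using ex_intact_path[OF assms(1)] by blast
  then obtain a where "a \<in> A" "\<pi> a = i"
    using \<pi> unfolding bij_betw_def by (metis imageE lessThan_iff)
  moreover obtain d' where "d a = Suc d'"
    using assms(4)[OF \<open>a \<in> A\<close>] not0_implies_Suc by blast
  ultimately show ?thesis
    using that coords[of a] target_coords_edge[OF \<open>i < p\<close> _ intact, of d'] by auto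
qed

lemma forces_meeting_sweep_assigned:
  assumes "finite T" "T \<subseteq> {..k}" "e \<in> T" "y \<in> T" "opposed S y e"
    and \<pi>: "bij_betw \<pi> (T - {e}) {..<p}"
    and "pos e = node 0 0"
    and "\<And>a. a \<in> T - {e} \<Longrightarrow> d a \<le> Suc (len (\<pi> a)) \<and> pos a = target_coords S e a (\<pi> a) (d a)"
  shows "forces_meeting V E k S pos"
  using assms(7-)
proof (induction "\<Sum>a\<in>T - {e}. d a" arbitrary: pos d rule: less_induct)
  case less
  have path_less: "\<pi> a < p" if "a \<in> T - {e}" for a
    using \<pi> that by (auto simp: bij_betw_def)
  show ?case
  proof (cases "\<exists>a\<in>T - {e}. d a = 0")
    case True
    then obtain a where "a \<in> T - {e}" "pos a = target_coords S e a (\<pi> a) 0"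
      using less.prems(2) by metis
    moreover have "y \<in> T - {e}"
      using assms(4,5) by (auto simp: opposed_def)
    moreover from this have "pos y \<in> node (\<pi> y) ` {..Suc (len (\<pi> y))}"
      using less.prems(2)[of y] image_target_coords[of S e y "\<pi> y"] by auto
    ultimately show ?thesis
      using forces_meeting_target_reached[of e k pos a "\<pi> a" S y "\<pi> y"] less.prems(1)
        assms(2,3,5) path_less by auto
  next
    case False
    show ?thesis
    proof (rule forces_meeting.move)
      fix R assume "adm_removal V E R"
      then obtain a d' where step: "a \<in> T - {e}" "d a = Suc d'"
        and edge: "{pos a, target_coords S e a (\<pi> a) d'} \<in> E - R"
        using False by (elim ex_step_towards_target[OF _ \<pi> less.prems(2)]) auto
      have "(\<Sum>b\<in>T - {e}. (d(a := d')) b) < (\<Sum>b\<in>T - {e}. d b)"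
        using step assms(1) by (intro sum_strict_mono_ex1) auto
      then have "forces_meeting V E k S (pos(a := target_coords S e a (\<pi> a) d'))"
        by (rule less.hyps) (use less.prems less.prems(2)[OF step(1)] step in auto)
      then show "\<exists>a v. a \<le> k \<and> {pos a, v} \<in> E - R \<and> forces_meeting V E k S (pos(a := v))"
        using edge step(1) assms(2) by blast
    qed
  qed
qed

definition inside :: "nat set \<Rightarrow> (nat \<Rightarrow> 'v) \<Rightarrow> nat set" where
  "inside T pos = {a \<in> T. pos a \<notin> poles}"

definition spread :: "nat set \<Rightarrow> (nat \<Rightarrow> 'v) \<Rightarrow> bool" where
  "spread T pos \<longleftrightarrow>
     (\<forall>i<p. \<forall>a\<in>T. \<forall>b\<in>T. pos a \<in> interior i \<and> pos b \<in> interior i \<longrightarrow> a = b)"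

lemma not_spreadE:
  assumes "\<not> spread T pos"
  obtains q a b i j where "q < p" "a \<in> T" "b \<in> T" "a \<noteq> b"
    "pos a = node q i" "pos b = node q j" "1 \<le> i" "i \<le> j" "j \<le> len q"
proof -
  obtain q a b where pair: "q < p" "a \<in> T" "b \<in> T" "a \<noteq> b"
    and interior: "pos a \<in> interior q" "pos b \<in> interior q"
    using assms unfolding spread_def by blast
  from interior obtain i j where coords: "i \<in> {1..len q}" "j \<in> {1..len q}"
    "pos a = node q i" "pos b = node q j"
    by (auto simp: interior_def)
  consider "i \<le> j" | "j \<le> i"
    by linarith
  then show ?thesis
  proof cases
    case 1
    then show ?thesis
      using pair coords by (intro that[of q a b i j]) auto
  next
    case 2
    then show ?thesis
      using pair coords by (intro that[of q b a j i]) auto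
  qed
qed

lemma spread_imp_inj_on_inside:
  assumes "spread T pos" "pos ` T \<subseteq> V"
  obtains g where "inj_on g (inside T pos)" "g ` inside T pos \<subseteq> {..<p}"
    "\<And>a. a \<in> inside T pos \<Longrightarrow> pos a \<in> interior (g a)"
proof -
  have "\<exists>i<p. pos a \<in> interior i" if "a \<in> inside T pos" for a
  proof -
    have "pos a \<in> V"
      using that assms(2) by (auto simp: inside_def)
    then obtain i j where "i < p" "j \<le> Suc (len i)" "pos a = node i j"
      by (auto simp: V_eq)
    moreover from this have "1 \<le> j" "j \<le> len i"
      using that node_in_poles_iff[of i j] by (auto simp: inside_def)
    ultimately show ?thesis
      by (auto simp: interior_def)
  qed
  then obtain g where g_interior: "\<And>a. a \<in> inside T pos \<Longrightarrow> g a < p \<and> pos a \<in> interior (g a)"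
    by metis
  have "inj_on g (inside T pos)"
    using assms(1) g_interior by (auto simp: inj_on_def spread_def inside_def) metis
  then show ?thesis
    using that g_interior by blast
qed

lemma ex_path_assignment:
  assumes "finite T" "card T = Suc p" "e \<in> T" "pos e \<in> poles"
    and "spread T pos" "pos ` T \<subseteq> V"
  obtains \<pi> where "bij_betw \<pi> (T - {e}) {..<p}"
    "\<And>a. a \<in> T - {e} \<Longrightarrow> pos a \<in> node (\<pi> a) ` {..Suc (len (\<pi> a))}"
proof -
  obtain g where g: "inj_on g (inside T pos)" "g ` inside T pos \<subseteq> {..<p}"
    "\<And>a. a \<in> inside T pos \<Longrightarrow> pos a \<in> interior (g a)"
    using spread_imp_inj_on_inside[OF assms(5,6)] by blast
  have "inside T pos \<subseteq> T - {e}"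
    using assms(4) by (auto simp: inside_def)
  then obtain \<pi> where \<pi>: "bij_betw \<pi> (T - {e}) {..<p}"
    "\<And>a. a \<in> inside T pos \<Longrightarrow> \<pi> a = g a"
    using bij_betw_extension[OF _ _ _ _ g(1,2), of "T - {e}"] assms(1-3) by auto
  have "pos a \<in> node (\<pi> a) ` {..Suc (len (\<pi> a))}" if agent: "a \<in> T - {e}" for a
  proof (cases "a \<in> inside T pos")
    case True
    then show ?thesis
      using g(3) \<pi>(2) by (fastforce simp: interior_def)
  next
    case False
    have "\<pi> a < p"
      using \<pi>(1) agent by (auto simp: bij_betw_def)
    moreover have "pos a \<in> poles"
      using False agent by (simp add: inside_def)
    ultimately show ?thesis
      using left_pole_eq[OF p_pos, of "\<pi> a"] right_pole_eq[OF p_pos, of "\<pi> a"]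
      by (auto simp: poles_def)
  qed
  with \<pi>(1) show ?thesis
    by (rule that)
qed

lemma forces_meeting_sweep:
  assumes "finite T" "card T = Suc p" "T \<subseteq> {..k}" "e \<in> T" "y \<in> T" "opposed S y e"
    and "pos ` T \<subseteq> V" "spread T pos" "pos e = node 0 0"
  shows "forces_meeting V E k S pos"
proof -
  have "pos e \<in> poles"
    using assms(9) by (simp add: poles_def)
  then obtain \<pi> where \<pi>: "bij_betw \<pi> (T - {e}) {..<p}"
    "\<And>a. a \<in> T - {e} \<Longrightarrow> pos a \<in> node (\<pi> a) ` {..Suc (len (\<pi> a))}"
    using ex_path_assignment[OF assms(1,2,4) _ assms(8,7)] by blast
  then have "\<exists>d\<le>Suc (len (\<pi> a)). pos a = target_coords S e a (\<pi> a) d" if "a \<in> T - {e}" for a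
    using \<pi>(2)[OF that] unfolding image_target_coords[of S e a, symmetric] by auto
  then obtain d where "\<And>a. a \<in> T - {e} \<Longrightarrow>
      d a \<le> Suc (len (\<pi> a)) \<and> pos a = target_coords S e a (\<pi> a) (d a)"
    by metis
  then show ?thesis
    by (rule forces_meeting_sweep_assigned
        [where pos = pos and d = d, OF assms(1,3-6) \<pi>(1) assms(9)])
qed

end

context theta_paths
begin

interpretation mirror: theta_paths V E p len "mirrored len node"
  by (rule theta_paths_mirrored)

lemma spread_mirrored: "mirror.spread T pos \<longleftrightarrow> spread T pos"
proof -
  have "mirror.interior i = interior i" for i
  proof -
    have "mirror.interior i = node i ` (\<lambda>j. Suc (len i) - j) ` {1..len i}"
      unfolding mirror.interior_def image_image by (simp add: mirrored_def)
    then show ?thesis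
      by (simp add: interior_def image_diff_atLeastAtMost_nat)
  qed
  then show ?thesis
    by (simp add: mirror.spread_def spread_def)
qed

lemma forces_meeting_if_spread:
  assumes "finite T" "card T = Suc p" "T \<subseteq> {..k}" "s \<in> T" "u \<in> T" "opposed S s u"
    and "pos ` T \<subseteq> V" "spread T pos"
  shows "forces_meeting V E k S pos"
proof -
  obtain g where "inj_on g (inside T pos)" "g ` inside T pos \<subseteq> {..<p}"
    by (rule spread_imp_inj_on_inside[OF assms(8,7)])
  then have "card (inside T pos) \<le> card {..<p}"
    by (intro card_inj_on_le) auto
  then have "inside T pos \<noteq> T"
    using assms(2) by auto
  then obtain e where "e \<in> T" "pos e \<in> poles"
    by (auto simp: inside_def)
  obtain y where "y \<in> T" "opposed S y e"
    using assms(4-6) unfolding opposed_def by metis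
  have "pos e = node 0 0 \<or> pos e = mirrored len node 0 0"
    using \<open>pos e \<in> poles\<close> by (simp add: poles_def mirrored_def)
  then show ?thesis
  proof
    assume "pos e = node 0 0"
    with assms(1-3) \<open>e \<in> T\<close> \<open>y \<in> T\<close> \<open>opposed S y e\<close> assms(7,8) show ?thesis
      by (rule forces_meeting_sweep)
  next
    assume "pos e = mirrored len node 0 0"
    with assms(1-3) \<open>e \<in> T\<close> \<open>y \<in> T\<close> \<open>opposed S y e\<close> assms(7) assms(8)[folded spread_mirrored]
    show ?thesis
      by (rule mirror.forces_meeting_sweep)
  qed
qed

lemma card_inside_upd_less:
  assumes "finite T" "a \<in> inside T pos" "b \<in> inside T pos" "x \<in> poles \<or> y \<in> poles" "a \<noteq> b"
  shows "card (inside T (pos(a := x, b := y))) < card (inside T pos)"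
proof (rule psubset_card_mono)
  have "inside T (pos(a := x, b := y)) \<subseteq> inside T pos"
    "\<not> {a, b} \<subseteq> inside T (pos(a := x, b := y))"
    using assms(2-) by (auto simp: inside_def)
  with assms(2,3) show "inside T (pos(a := x, b := y)) \<subset> inside T pos"
    by blast
qed (use assms(1) in \<open>simp add: inside_def\<close>)

lemma forces_meeting_if_enough_agents:
  assumes "finite T" "card T = Suc p" "T \<subseteq> {..k}" "s \<in> T" "u \<in> T" "opposed S s u"
    and "pos ` T \<subseteq> V"
  shows "forces_meeting V E k S pos"
  using assms(7)
proof (induction "card (inside T pos)" arbitrary: pos rule: less_induct)
  case less
  show ?case
  proof (cases "spread T pos")
    case True
    with assms(1-6) less.prems show ?thesis
      by (rule forces_meeting_if_spread)
  next
    case False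
    then obtain q a b i j where path: "q < p" and agents: "a \<in> T" "b \<in> T" "a \<noteq> b"
      and coords: "pos a = node q i" "pos b = node q j" "1 \<le> i" "i \<le> j" "j \<le> len q"
      by (rule not_spreadE)
    have inside: "a \<in> inside T pos" "b \<in> inside T pos"
      using path agents coords by (simp_all add: inside_def node_in_poles_iff)
    have "a \<le> k" "b \<le> k"
      using agents(1,2) assms(3) by auto
    then show ?thesis
    proof (rule forces_meeting_drive_out[OF path _ _ agents(3) coords(1,2,4)])
      fix x y assume "x \<in> V" "y \<in> V" "x \<in> poles \<or> y \<in> poles"
      then show "forces_meeting V E k S (pos(a := x, b := y))"
        using less.prems card_inside_upd_less[OF assms(1) inside _ agents(3)]
        by (intro less.hyps) auto
    qed (use coords(5) in simp)
  qed
qed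

lemma broadcast_solvable_if_enough_agents:
  assumes "p \<le> k"
  shows "broadcast_solvable V E k"
proof (rule broadcast_solvableI, rule wins_if_meetings_forced[OF finite_E Union_E_subset])
  fix pos :: "nat \<Rightarrow> 'v" and S
  assume valid: "pos ` {..k} \<subseteq> V" and "S \<inter> {..k} \<noteq> {}" "\<not> {..k} \<subseteq> S"
  from this(2,3) obtain s u where agents: "s \<le> k" "u \<le> k" and kinds: "s \<in> S" "u \<notin> S"
    by auto
  have "\<exists>T. {s, u} \<subseteq> T \<and> T \<subseteq> {..k} \<and> card T = Suc p"
    using agents kinds assms p_pos by (intro exists_subset_between) (auto simp: card_insert_if)
  then obtain T where "s \<in> T" "u \<in> T" "T \<subseteq> {..k}" "card T = Suc p"
    by auto
  moreover from this have "finite T" "pos ` T \<subseteq> V"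
    using finite_subset valid by blast+
  moreover have "opposed S s u"
    using kinds by (simp add: opposed_def)
  ultimately show "forces_meeting V E k S pos"
    by (intro forces_meeting_if_enough_agents)
qed auto

end

lemma (in long_theta_paths) broadcast_solvable_iff:
  "1 \<le> k \<Longrightarrow> broadcast_solvable V E k \<longleftrightarrow> p \<le> k"
  using not_broadcast_solvable_if_too_few_agents broadcast_solvable_if_enough_agents not_less
  by blast

section \<open>Generalized theta graphs\<close>

definition theta_node :: "nat list \<Rightarrow> nat \<Rightarrow> nat \<Rightarrow> tvert" where
  "theta_node ls i j =
     (if j = 0 then Pole False else if j = Suc (ls ! i) then Pole True else Inner i j)"

lemma card_theta_V: "card (theta_V ls) = sum_list ls + 2"
proof -
  let ?I = "SIGMA i:{..<length ls}. {1..ls ! i}"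
  let ?inner = "(\<lambda>(i, j). Inner i j) ` ?I"
  have "card ?inner = card ?I"
    by (intro card_image) (auto simp: inj_on_def)
  also have "\<dots> = sum_list ls"
    by (simp add: sum_list_sum_nth atLeast0LessThan)
  finally have "card ?inner = sum_list ls" .
  moreover have "card ({Pole False, Pole True} \<union> ?inner) =
      card {Pole False, Pole True} + card ?inner"
    by (intro card_Un_disjoint) auto
  moreover have "theta_V ls = {Pole False, Pole True} \<union> ?inner"
    by (auto simp: theta_V_def)
  ultimately show ?thesis
    by simp
qed

lemma image_theta_node:
  "theta_node ls i ` {..Suc (ls ! i)} = {Pole False, Pole True} \<union> Inner i ` {1..ls ! i}"
proof -
  have "{..Suc (ls ! i)} = {0, Suc (ls ! i)} \<union> {1..ls ! i}"
    by auto
  moreover have "theta_node ls i ` {1..ls ! i} = Inner i ` {1..ls ! i}"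
    by (intro image_cong) (auto simp: theta_node_def)
  ultimately show ?thesis
    by (simp only: image_Un) (auto simp: theta_node_def)
qed

lemma theta_V_eq_theta_node:
  assumes "ls \<noteq> []"
  shows "theta_V ls = (\<Union>i<length ls. theta_node ls i ` {..Suc (ls ! i)})"
  unfolding image_theta_node using assms by (auto simp: theta_V_def)

lemma image_link_theta_node:
  assumes "1 \<le> ls ! i"
  shows "link (theta_node ls) i ` {..ls ! i} =
    {{Pole False, Inner i 1}, {Inner i (ls ! i), Pole True}} \<union>
    (\<lambda>j. {Inner i j, Inner i (Suc j)}) ` {1..<ls ! i}"
proof -
  have "{..ls ! i} = {0, ls ! i} \<union> {1..<ls ! i}"
    by auto
  moreover have "link (theta_node ls) i ` {1..<ls ! i} =
      (\<lambda>j. {Inner i j, Inner i (Suc j)}) ` {1..<ls ! i}"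
    by (intro image_cong) (auto simp: link_def theta_node_def)
  ultimately show ?thesis
    using assms by (simp only: image_Un) (simp add: link_def theta_node_def)
qed

lemma theta_E_eq_link:
  assumes "\<forall>l\<in>set ls. 1 \<le> l"
  shows "theta_E ls = (\<Union>i<length ls. link (theta_node ls) i ` {..ls ! i})"
proof -
  have ls_pos: "1 \<le> ls ! i" if "i < length ls" for i
    using assms that by simp
  have "(\<Union>i<length ls. link (theta_node ls) i ` {..ls ! i}) =
    (\<Union>i<length ls. {{Pole False, Inner i 1}, {Inner i (ls ! i), Pole True}} \<union>
      (\<lambda>j. {Inner i j, Inner i (Suc j)}) ` {1..<ls ! i})"
    using ls_pos by (intro SUP_cong image_link_theta_node) auto
  also have "\<dots> = theta_E ls"
    using ls_pos by (fastforce simp: theta_E_def)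
  finally show ?thesis ..
qed

lemma theta_paths_theta:
  assumes "ls \<noteq> []" "\<forall>l\<in>set ls. 1 \<le> l"
  shows "theta_paths (theta_V ls) (theta_E ls) (length ls) ((!) ls) (theta_node ls)"
proof
  show "1 \<le> ls ! i" if "i < length ls" for i
    using assms(2) that by simp
  show "theta_node ls i j = theta_node ls i' j' \<longleftrightarrow>
      i = i' \<and> j = j' \<or> j = 0 \<and> j' = 0 \<or> j = Suc (ls ! i) \<and> j' = Suc (ls ! i')" for i i' j j'
    by (auto simp: theta_node_def)
qed (use assms theta_V_eq_theta_node theta_E_eq_link in auto)

lemma card_theta_E:
  assumes "ls \<noteq> []" "\<forall>l\<in>set ls. 1 \<le> l"
  shows "card (theta_E ls) = sum_list ls + length ls"
proof -
  interpret theta_paths "theta_V ls" "theta_E ls" "length ls" "(!) ls" "theta_node ls"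
    using assms by (rule theta_paths_theta)
  show ?thesis
    by (simp only: card_E Suc_eq_plus1 sum.distrib) (simp add: sum_list_sum_nth atLeast0LessThan)
qed

theorem broadcast_solvable_theta_iff:
  assumes "ls \<noteq> []" "\<forall>l\<in>set ls. 2 \<le> l" "1 \<le> k"
  shows "broadcast_solvable (theta_V ls) (theta_E ls) k \<longleftrightarrow> length ls \<le> k"
proof -
  have "\<forall>l\<in>set ls. 1 \<le> l"
    using assms(2) by auto
  then interpret theta_paths "theta_V ls" "theta_E ls" "length ls" "(!) ls" "theta_node ls"
    using assms(1) by (intro theta_paths_theta)
  interpret long_theta_paths "theta_V ls" "theta_E ls" "length ls" "(!) ls" "theta_node ls"
    by unfold_locales (use assms(2) in simp)
  show ?thesis
    using assms(3) by (rule broadcast_solvable_iff)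
qed

theorem theorem3:
  fixes f :: "nat \<Rightarrow> nat" and n :: nat
  assumes "filterlim f at_top at_top"
    and "2 < n" and "3 \<le> f n" and "f n dvd (n - 2)"
  shows "let p = (n - 2) div f n;
             V = theta_V (replicate p (f n));
             E = theta_E (replicate p (f n))
         in card V = n
            \<and> real (card E) = real n * (1 + 1 / real (f n)) - 2 * (1 + 1 / real (f n))
            \<and> real (card E) / real (card V)
                = 1 + 1 / real (f n) - 2 / real n * (1 + 1 / real (f n))
            \<and> (\<forall>k\<ge>1. broadcast_solvable V E k \<longleftrightarrow> p \<le> k)"
proof -
  define p where "p = (n - 2) div f n"
  define ls where "ls = replicate p (f n)"
  have n_eq: "n = p * f n + 2"
    using assms by (simp add: p_def)
  then have "p \<noteq> 0"
    using assms(2) by (metis add_0 less_irrefl mult_0)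
  then have nonempty: "ls \<noteq> []" and lengths: "\<forall>l\<in>set ls. 1 \<le> l" "\<forall>l\<in>set ls. 2 \<le> l"
    using assms(3) by (auto simp: ls_def)
  have card_V: "card (theta_V ls) = n"
    using n_eq by (simp add: card_theta_V ls_def sum_list_replicate)
  have "card (theta_E ls) = p * f n + p"
    using card_theta_E[OF nonempty lengths(1)] by (simp add: ls_def sum_list_replicate)
  then have card_E: "real (card (theta_E ls)) =
      real n * (1 + 1 / real (f n)) - 2 * (1 + 1 / real (f n))"
    using assms(3) by (subst n_eq) (simp add: field_simps)
  then have "real (card (theta_E ls)) / real n =
      1 + 1 / real (f n) - 2 / real n * (1 + 1 / real (f n))"
    using assms(2) by (simp add: field_simps)
  with card_V card_E broadcast_solvable_theta_iff[OF nonempty lengths(2)] show ?thesis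
    by (simp add: Let_def ls_def flip: p_def)
qed

end
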